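(* For each fixed integer $n\ge 2$, $$\frac{\mathcal{Z}^{(n)}_m-\mathbb{E}(\mathcal{Z}^{(n)}_m)}{\sqrt{\mathbb{V}(\mathcal{Z}^{(n)}_m)}}\ \xrightarrow{\ d\ }\ \mathcal{N}\qquad\text{as } m\to\infty .$$ More generally, let $\beta<1/2$ and let $(n_m)$ be a sequence of integers with $n_m\ge2$ for every $m$ and $n_m\le m^\beta$ for all sufficiently large $m$. Then $$\frac{\mathcal{Z}^{(n_m)}_m-\mathbb{E}(\mathcal{Z}^{(n_m)}_m)}{\sqrt{\mathbb{V}(\mathcal{Z}^{(n_m)}_m)}}\ \xrightarrow{\ d\ }\ \mathcal{N}\qquad\text{as } m\to\infty .$$
   Context: For each integer $n\ge1$, $X^{(n)}_1,X^{(n)}_2,\ldots$ is a sequence of independent random variables uniformly distributed in $\{1,\ldots,n\}$, defined on a probability space with probability $\mathbf{P}$; $\mathbb{E}$ and $\mathbb{V}$ denote expectation and variance. For $m\ge2$, $$\mathcal{Z}^{(n)}_m=\sum_{1\le i<j\le m}\gcd(X^{(n)}_i,X^{(n)}_j).$$ The symbol $\xrightarrow{d}$ means convergence in distribution and $\mathcal{N}$ is a standard normal variable. *)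

theory Defs
  imports "HOL-Probability.Probability"
begin

definition gcd_sum :: "(nat \<Rightarrow> 'a \<Rightarrow> nat) \<Rightarrow> nat \<Rightarrow> 'a \<Rightarrow> real" where
  "gcd_sum X m \<omega> = (\<Sum>(i, j)\<in>{(i, j). 1 \<le> i \<and> i < j \<and> j \<le> m}. real (gcd (X i \<omega>) (X j \<omega>)))"

definition standardized :: "'a measure \<Rightarrow> ('a \<Rightarrow> real) \<Rightarrow> 'a \<Rightarrow> real" where
  "standardized M Z \<omega> =
     (Z \<omega> - prob_space.expectation M Z) / sqrt (prob_space.variance M Z)"

end

theory Submission
  imports Defs
begin

text \<open>
  The sum of \<open>gcd (X i) (X j)\<close> over all pairs is a U-statistic, and the proof splits it by
  Hoeffding's decomposition. Write \<open>h\<close> for a symmetric kernel with mean \<open>\<mu>\<close>, and put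
  \<open>g x = E (h x Y) - \<mu>\<close> and \<open>k x y = h x y - \<mu> - g x - g y\<close>
  (\<open>proj\<close> and \<open>resid\<close> in the formal text). Then the centred sum is
  \<open>(m - 1) * (g (X 1) + \<dots> + g (X m))\<close> plus the sum of the \<open>k (X i) (X j)\<close>. Averaging \<open>k\<close>
  over either argument gives \<open>0\<close>; this makes all the terms \<open>k (X i) (X j)\<close> orthogonal to each
  other and to the linear part. With \<open>v = E (g X)\<^sup>2\<close> and \<open>\<bar>h\<bar> \<le> B\<close>, the linear part has variance
  \<open>(m - 1)\<^sup>2 * m * v\<close>, while the variance of the remainder is at most of order \<open>m\<^sup>2 * B\<^sup>2\<close>.
  So after standardization the sum differs in \<open>L\<^sup>2\<close> from the normalized linear part by
  at most a constant multiple of \<open>\<theta> = sqrt (B\<^sup>2 / (m * v))\<close>.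

  The characteristic function of a random variable changes by at most \<open>\<bar>t\<bar>\<close> times the
  \<open>L\<^sup>2\<close> distance (\<open>char_diff_le_L2\<close>), and the normalized linear part is a sum of independent
  summands bounded by \<open>2 * \<theta>\<close>, so a third-order Taylor estimate applies to it
  (\<open>char_normalized_sum_approx\<close>). Both errors are multiples of \<open>\<theta>\<close>. The resulting bound
  (\<open>char_standardized_U_approx\<close>) is explicit and does not refer to the distribution of the
  variables in any other way, so it may be used with a distribution and a kernel that change
  with \<open>m\<close>. Levy's continuity theorem gives a central limit theorem for such triangular arrays
  whenever \<open>\<theta>\<close> tends to \<open>0\<close> (\<open>U_statistic_triangular_CLT\<close>).

  For the gcd on \<open>{1..n}\<close> one can take \<open>B = n\<close>, and the growth condition \<open>n \<le> m powr \<beta>\<close> with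
  \<open>\<beta> < 1/2\<close> makes \<open>n\<^sup>2 / m\<close> tend to \<open>0\<close>. It remains to bound \<open>v\<close> from below
  independently of \<open>n\<close> (\<open>proj_var_truncated_gcd\<close>): if \<open>x\<close> is odd, passing from \<open>x\<close> to \<open>2 * x\<close>
  doubles the gcd with every even \<open>y\<close>, so \<open>g (2 * x) - g x \<ge> 1/3\<close>. A fixed proportion of
  \<open>{1..n}\<close> is covered by such disjoint pairs \<open>x, 2 * x\<close>, so \<open>g\<close> cannot have small variance.
\<close>

section \<open>Characteristic functions and mean square distance\<close>

lemma norm_iexp_diff_le: "cmod (iexp a - iexp b) \<le> \<bar>a - b\<bar>"
proof -
  have "iexp a - iexp b = iexp b * (iexp (a - b) - 1)"
    by (simp add: algebra_simps flip: exp_add)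
  then have "cmod (iexp a - iexp b) = cmod (iexp (a - b) - 1)"
    by (simp add: norm_mult)
  also have "\<dots> \<le> \<bar>a - b\<bar>"
    using iexp_approx1[of "a - b" 0] by simp
  finally show ?thesis .
qed

lemma (in prob_space) expectation_abs_le_sqrt:
  fixes W :: "'a \<Rightarrow> real"
  assumes "W \<in> borel_measurable M" "integrable M (\<lambda>x. (W x)\<^sup>2)"
  shows "expectation (\<lambda>x. \<bar>W x\<bar>) \<le> sqrt (expectation (\<lambda>x. (W x)\<^sup>2))"
proof -
  have int: "integrable M (\<lambda>x. \<bar>W x\<bar>)"
    using square_integrable_imp_integrable[OF assms] by simp
  have "0 \<le> variance (\<lambda>x. \<bar>W x\<bar>)" by (rule variance_positive)
  also have "\<dots> = expectation (\<lambda>x. (W x)\<^sup>2) - (expectation (\<lambda>x. \<bar>W x\<bar>))\<^sup>2"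
    using variance_eq[OF int] assms by simp
  finally show ?thesis by (intro real_le_rsqrt) simp
qed

text \<open>This replaces Slutsky's theorem: an \<open>L\<^sup>2\<close>-small perturbation is absorbed directly at the level of
  characteristic functions, with a quantitative error, because \<open>x \<mapsto> exp (\<i> * t * x)\<close> is
  \<open>\<bar>t\<bar>\<close>-Lipschitz and the \<open>L\<^sup>1\<close> norm is at most the \<open>L\<^sup>2\<close> norm.\<close>
lemma (in prob_space) char_diff_le_L2:
  fixes U V :: "'a \<Rightarrow> real"
  assumes [measurable]: "U \<in> borel_measurable M" "V \<in> borel_measurable M"
    and int: "integrable M (\<lambda>x. (U x - V x)\<^sup>2)"
  shows "cmod (char (distr M borel U) t - char (distr M borel V) t)
    \<le> \<bar>t\<bar> * sqrt (expectation (\<lambda>x. (U x - V x)\<^sup>2))"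
proof -
  have int1: "integrable M (\<lambda>x. \<bar>U x - V x\<bar>)"
    using square_integrable_imp_integrable[OF _ int] by simp
  have "char (distr M borel U) t - char (distr M borel V) t
      = (CLINT x|M. iexp (t * U x) - iexp (t * V x))"
    by (simp add: char_def integral_distr integrable_iexp)
  also have "cmod \<dots> \<le> expectation (\<lambda>x. cmod (iexp (t * U x) - iexp (t * V x)))"
    by (rule integral_norm_bound)
  also have "\<dots> \<le> expectation (\<lambda>x. \<bar>t\<bar> * \<bar>U x - V x\<bar>)"
  proof (rule integral_mono)
    show "cmod (iexp (t * U x) - iexp (t * V x)) \<le> \<bar>t\<bar> * \<bar>U x - V x\<bar>" for x
      using norm_iexp_diff_le[of "t * U x" "t * V x"]
      by (simp add: abs_mult flip: right_diff_distrib)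
  qed (use int1 in \<open>auto intro!: integrable_norm Bochner_Integration.integrable_diff integrable_iexp\<close>)
  also have "\<dots> \<le> \<bar>t\<bar> * sqrt (expectation (\<lambda>x. (U x - V x)\<^sup>2))"
    using expectation_abs_le_sqrt[OF _ int] by (auto intro!: mult_left_mono)
  finally show ?thesis .
qed

section \<open>Independence and orthogonality\<close>

text \<open>By Fubini, the expectation can be computed by averaging over \<open>X\<close> first, with \<open>Y\<close> frozen.
  Every orthogonality relation in the Hoeffding decomposition is an instance of this.\<close>
lemma (in prob_space) expectation_eq_0_if_sections_0:
  fixes f :: "'b \<times> 'b \<Rightarrow> real"
  assumes ind: "indep_var T Y S X" and [measurable]: "f \<in> borel_measurable (T \<Otimes>\<^sub>M S)"
    and int: "integrable M (\<lambda>\<omega>. f (Y \<omega>, X \<omega>))"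
    and zero: "\<And>y. y \<in> space T \<Longrightarrow> expectation (\<lambda>\<omega>. f (y, X \<omega>)) = 0"
  shows "expectation (\<lambda>\<omega>. f (Y \<omega>, X \<omega>)) = 0"
proof -
  have [measurable]: "Y \<in> measurable M T" "X \<in> measurable M S"
    and joint: "distr M T Y \<Otimes>\<^sub>M distr M S X = distr M (T \<Otimes>\<^sub>M S) (\<lambda>\<omega>. (Y \<omega>, X \<omega>))"
    using ind by (auto simp: indep_var_distribution_eq)
  interpret Y: prob_space "distr M T Y" by (rule prob_space_distr) simp
  interpret X: prob_space "distr M S X" by (rule prob_space_distr) simp
  interpret YX: pair_prob_space "distr M T Y" "distr M S X" ..
  have int': "integrable (distr M T Y \<Otimes>\<^sub>M distr M S X) f"
    unfolding joint using int by (simp add: integrable_distr_eq)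
  have "expectation (\<lambda>\<omega>. f (Y \<omega>, X \<omega>)) = integral\<^sup>L (distr M T Y \<Otimes>\<^sub>M distr M S X) f"
    unfolding joint by (simp add: integral_distr)
  also have "\<dots> = (\<integral>y. (\<integral>x. f (y, x) \<partial>distr M S X) \<partial>distr M T Y)"
    by (rule YX.integral_fst'[OF int', symmetric])
  also have "\<dots> = (\<integral>y. 0 \<partial>distr M T Y)"
    by (rule Bochner_Integration.integral_cong) (auto simp: zero integral_distr)
  finally show ?thesis by simp
qed

lemma (in prob_space) expectation_power2_orthogonal_sum:
  fixes Y :: "'i \<Rightarrow> 'a \<Rightarrow> real"
  assumes "finite A"
    and int: "\<And>p q. p \<in> A \<Longrightarrow> q \<in> A \<Longrightarrow> integrable M (\<lambda>\<omega>. Y p \<omega> * Y q \<omega>)"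
    and orth: "\<And>p q. p \<in> A \<Longrightarrow> q \<in> A \<Longrightarrow> p \<noteq> q \<Longrightarrow> expectation (\<lambda>\<omega>. Y p \<omega> * Y q \<omega>) = 0"
  shows "integrable M (\<lambda>\<omega>. (\<Sum>p\<in>A. Y p \<omega>)\<^sup>2)"
    and "expectation (\<lambda>\<omega>. (\<Sum>p\<in>A. Y p \<omega>)\<^sup>2) = (\<Sum>p\<in>A. expectation (\<lambda>\<omega>. (Y p \<omega>)\<^sup>2))"
proof -
  have eq: "(\<Sum>p\<in>A. Y p \<omega>)\<^sup>2 = (\<Sum>p\<in>A. \<Sum>q\<in>A. Y p \<omega> * Y q \<omega>)" for \<omega>
    by (simp add: power2_eq_square sum_product)
  show "integrable M (\<lambda>\<omega>. (\<Sum>p\<in>A. Y p \<omega>)\<^sup>2)"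
    unfolding eq by (intro Bochner_Integration.integrable_sum int)
  have "expectation (\<lambda>\<omega>. (\<Sum>p\<in>A. Y p \<omega>)\<^sup>2)
      = (\<Sum>p\<in>A. \<Sum>q\<in>A. expectation (\<lambda>\<omega>. Y p \<omega> * Y q \<omega>))"
    unfolding eq by (simp add: Bochner_Integration.integral_sum int Bochner_Integration.integrable_sum)
  also have "\<dots> = (\<Sum>p\<in>A. \<Sum>q\<in>A. if q = p then expectation (\<lambda>\<omega>. Y p \<omega> * Y p \<omega>) else 0)"
    using orth by (intro sum.cong) auto
  also have "\<dots> = (\<Sum>p\<in>A. expectation (\<lambda>\<omega>. (Y p \<omega>)\<^sup>2))"
    using \<open>finite A\<close> by (simp add: power2_eq_square)
  finally show "expectation (\<lambda>\<omega>. (\<Sum>p\<in>A. Y p \<omega>)\<^sup>2) = (\<Sum>p\<in>A. expectation (\<lambda>\<omega>. (Y p \<omega>)\<^sup>2))" .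
qed

text \<open>Adding to \<open>T\<close> an orthogonal \<open>R\<close> of relative size \<open>r / a\<^sup>2\<close> and renormalizing moves the
  standardized variable little: with \<open>s = sqrt (a\<^sup>2 + r)\<close> the two unit vectors have inner product
  \<open>a / s\<close>, so their squared distance is \<open>2 * (1 - a / s) = 2 * r / (s * (s + a))\<close>.\<close>
lemma (in prob_space) standardized_orthogonal_sum_L2:
  fixes T R :: "'a \<Rightarrow> real"
  assumes intT: "integrable M (\<lambda>x. (T x)\<^sup>2)" and intR: "integrable M (\<lambda>x. (R x)\<^sup>2)"
    and intTR: "integrable M (\<lambda>x. T x * R x)" and orth: "expectation (\<lambda>x. T x * R x) = 0"
    and a: "a > 0" "expectation (\<lambda>x. (T x)\<^sup>2) = a\<^sup>2"
    and r: "expectation (\<lambda>x. (R x)\<^sup>2) = r"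
  shows "integrable M (\<lambda>x. ((T x + R x) / sqrt (a\<^sup>2 + r) - T x / a)\<^sup>2)"
    and "expectation (\<lambda>x. ((T x + R x) / sqrt (a\<^sup>2 + r) - T x / a)\<^sup>2) \<le> r / a\<^sup>2"
proof -
  define s where "s = sqrt (a\<^sup>2 + r)"
  have r0: "r \<ge> 0" unfolding r[symmetric] by simp
  then have s2: "s\<^sup>2 = a\<^sup>2 + r" by (simp add: s_def)
  have as: "a \<le> s" unfolding s_def using r0 by (intro real_le_rsqrt) simp
  then have s: "s > 0" using a by simp
  have expand: "((T x + R x) / s - T x / a)\<^sup>2
    = (1 / s - 1 / a)\<^sup>2 * (T x)\<^sup>2 + (2 * (1 / s - 1 / a) / s) * (T x * R x) + (1 / s\<^sup>2) * (R x)\<^sup>2" for x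
    using a s by (simp add: field_simps power2_eq_square)
  show "integrable M (\<lambda>x. ((T x + R x) / sqrt (a\<^sup>2 + r) - T x / a)\<^sup>2)"
    unfolding s_def[symmetric] expand
    by (intro Bochner_Integration.integrable_add integrable_mult_right intT intR intTR)
  have "expectation (\<lambda>x. ((T x + R x) / s - T x / a)\<^sup>2) = (1 / s - 1 / a)\<^sup>2 * a\<^sup>2 + (1 / s\<^sup>2) * r"
    unfolding expand using intT intR intTR by (simp add: a r orth)
  also have "\<dots> = 2 * (s - a) / s"
  proof -
    have "(1 / s - 1 / a)\<^sup>2 * a\<^sup>2 + (1 / s\<^sup>2) * r = ((a - s)\<^sup>2 + r) / s\<^sup>2"
      using a s by (simp add: field_simps power2_eq_square)
    also have "(a - s)\<^sup>2 + r = 2 * (s - a) * s"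
      using s2 by (simp add: power2_eq_square algebra_simps)
    finally show ?thesis using s by (simp add: power2_eq_square)
  qed
  also have "\<dots> \<le> r / a\<^sup>2"
  proof -
    have "2 * (s - a) * a \<le> (s - a) * (s + a)"
      using mult_left_mono[of "2 * a" "s + a" "s - a"] as by (simp add: mult_ac)
    also have "\<dots> = r" using s2 by (simp add: power2_eq_square algebra_simps)
    finally have "2 * (s - a) \<le> r / a" using a by (simp add: field_simps)
    then have "2 * (s - a) / s \<le> (r / a) / a"
      using a as s r0 by (intro frac_le) auto
    then show ?thesis by (simp add: power2_eq_square)
  qed
  finally show "expectation (\<lambda>x. ((T x + R x) / sqrt (a\<^sup>2 + r) - T x / a)\<^sup>2) \<le> r / a\<^sup>2"
    by (simp add: s_def)
qed

section \<open>Pairs of indices\<close>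

definition index_pairs :: "nat \<Rightarrow> (nat \<times> nat) set" where
  "index_pairs m = {(i, j). 1 \<le> i \<and> i < j \<and> j \<le> m}"

lemma finite_index_pairs [simp]: "finite (index_pairs m)"
  by (rule finite_subset[of _ "{..m} \<times> {..m}"]) (auto simp: index_pairs_def)

text \<open>Each index occurs in \<open>m - 1\<close> pairs; hence the factor in front of the linear part.\<close>
lemma sum_index_pairs_endpoints:
  fixes f :: "nat \<Rightarrow> real"
  shows "(\<Sum>(i, j)\<in>index_pairs m. f i + f j) = (real m - 1) * (\<Sum>i=1..m. f i)"
proof (induction m)
  case 0
  have "index_pairs 0 = {}" by (auto simp: index_pairs_def)
  then show ?case by simp
next
  case (Suc m)
  have eq: "index_pairs (Suc m) = index_pairs m \<union> (\<lambda>i. (i, Suc m)) ` {1..m}"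
    by (auto simp: index_pairs_def)
  have "(\<Sum>(i, j)\<in>index_pairs (Suc m). f i + f j)
      = (\<Sum>(i, j)\<in>index_pairs m. f i + f j) + (\<Sum>(i, j)\<in>(\<lambda>i. (i, Suc m)) ` {1..m}. f i + f j)"
    unfolding eq by (rule sum.union_disjoint) (simp_all, auto simp: index_pairs_def)
  also have "(\<Sum>(i, j)\<in>(\<lambda>i. (i, Suc m)) ` {1..m}. f i + f j) = (\<Sum>i=1..m. f i + f (Suc m))"
    by (subst sum.reindex) (auto intro: inj_onI)
  finally show ?case
    by (simp add: Suc sum.distrib algebra_simps)
qed

text \<open>The endpoint sum with constant weight \<open>1 / 2\<close> counts every pair once.\<close>
lemma card_index_pairs: "real (card (index_pairs m)) = real m * (real m - 1) / 2"
  using sum_index_pairs_endpoints[of "\<lambda>_. 1 / 2" m] by (simp add: case_prod_unfold)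

section \<open>Normalized sums of bounded independent variables\<close>

text \<open>The third absolute moment of a variable bounded by \<open>b\<close> is at most \<open>b\<close> times its variance
  \<open>1 / card A\<close>. Thus each factor of the characteristic function misses its second-order Taylor
  polynomial by \<open>\<bar>t\<bar> ^ 3 * b / (6 * card A)\<close>, and these errors add up because
  all factors have modulus at most \<open>1\<close>. The condition on \<open>t\<close> ensures this for the polynomials.\<close>
lemma (in prob_space) char_normalized_sum_approx:
  fixes Y :: "nat \<Rightarrow> 'a \<Rightarrow> real"
  assumes ind: "indep_vars (\<lambda>_. borel) Y A" and fin: "finite A" and A: "A \<noteq> {}"
    and bnd: "\<And>i \<omega>. i \<in> A \<Longrightarrow> \<bar>Y i \<omega>\<bar> \<le> b"
    and mean: "\<And>i. i \<in> A \<Longrightarrow> expectation (Y i) = 0"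
    and var: "\<And>i. i \<in> A \<Longrightarrow> expectation (\<lambda>\<omega>. (Y i \<omega>)\<^sup>2) = 1 / card A"
    and t: "t\<^sup>2 \<le> 4 * real (card A)"
  shows "cmod (char (distr M borel (\<lambda>\<omega>. \<Sum>i\<in>A. Y i \<omega>)) t - (1 + (- (t\<^sup>2) / 2) / card A) ^ card A)
    \<le> \<bar>t\<bar> ^ 3 * b / 6"
proof -
  define n where "n = real (card A)"
  have n: "n > 0" using fin A by (simp add: n_def card_gt_0_iff)
  define z where "z = complex_of_real (1 + (- (t\<^sup>2) / 2) / n)"
  have Ym [measurable]: "Y i \<in> borel_measurable M" if "i \<in> A" for i
    using ind that by (auto simp: indep_vars_def2)
  have single: "cmod (char (distr M borel (Y i)) t - z) \<le> \<bar>t\<bar> ^ 3 * b / 6 / n" if i: "i \<in> A" for i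
  proof -
    note [measurable] = Ym[OF i]
    have b: "0 \<le> b" using bnd[OF i, of undefined] by linarith
    have Y1: "integrable M (Y i)"
      using bnd[OF i] by (intro integrable_const_bound[where B=b]) auto
    have Y2: "integrable M (\<lambda>\<omega>. (Y i \<omega>)\<^sup>2)"
      using bnd[OF i] power_mono[OF bnd[OF i] abs_ge_zero, of _ 2]
      by (intro integrable_const_bound[where B="b\<^sup>2"]) auto
    have "cmod (char (distr M borel (Y i)) t - (1 - t\<^sup>2 * (1 / n) / 2))
        \<le> (t\<^sup>2 / 6) * expectation (\<lambda>x. min (6 * (Y i x)\<^sup>2) (\<bar>t\<bar> * \<bar>Y i x\<bar> ^ 3))"
      by (rule char_approx3'[OF _ Y1 Y2 mean[OF i]]) (simp_all add: mean[OF i] var[OF i] n_def)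
    also have "\<dots> \<le> (t\<^sup>2 / 6) * expectation (\<lambda>x. \<bar>t\<bar> * b * (Y i x)\<^sup>2)"
    proof (intro mult_left_mono integral_mono)
      show "integrable M (\<lambda>x. min (6 * (Y i x)\<^sup>2) (\<bar>t\<bar> * \<bar>Y i x\<bar> ^ 3))"
        by (rule Bochner_Integration.integrable_bound[where f="\<lambda>x. 6 * (Y i x)\<^sup>2"]) (use Y2 in auto)
      show "min (6 * (Y i x)\<^sup>2) (\<bar>t\<bar> * \<bar>Y i x\<bar> ^ 3) \<le> \<bar>t\<bar> * b * (Y i x)\<^sup>2" for x
      proof -
        have "\<bar>Y i x\<bar> * (Y i x)\<^sup>2 \<le> b * (Y i x)\<^sup>2"
          by (intro mult_right_mono bnd i) simp
        also have "\<bar>Y i x\<bar> * (Y i x)\<^sup>2 = \<bar>Y i x\<bar> ^ 3"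
          by (simp add: power3_eq_cube power2_eq_square)
        finally have "\<bar>t\<bar> * \<bar>Y i x\<bar> ^ 3 \<le> \<bar>t\<bar> * (b * (Y i x)\<^sup>2)"
          by (rule mult_left_mono) simp
        then show ?thesis by (simp add: mult.assoc)
      qed
    qed (use Y2 in auto)
    also have "\<dots> = \<bar>t\<bar> ^ 3 * b / 6 / n"
      by (simp add: var[OF i] n_def) (simp add: power3_eq_cube power2_eq_square)
    also have "1 - t\<^sup>2 * (1 / n) / 2 = 1 + (- (t\<^sup>2) / 2) / n" by simp
    finally show ?thesis unfolding z_def .
  qed
  have z1: "cmod z \<le> 1"
    using t n unfolding z_def norm_of_real by (intro abs_leI) (auto simp: n_def field_simps)
  have "char (distr M borel (\<lambda>\<omega>. \<Sum>i\<in>A. Y i \<omega>)) t - z ^ card A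
      = (\<Prod>i\<in>A. char (distr M borel (Y i)) t) - (\<Prod>i\<in>A. z)"
    by (simp add: char_distr_sum[OF ind])
  also have "cmod \<dots> \<le> (\<Sum>i\<in>A. cmod (char (distr M borel (Y i)) t - z))"
    using z1 by (intro norm_prod_diff) (auto intro!: real_distribution.cmod_char_le_1 real_distribution_distr)
  also have "\<dots> \<le> (\<Sum>i\<in>A. \<bar>t\<bar> ^ 3 * b / 6 / n)"
    by (intro sum_mono single)
  also have "\<dots> = \<bar>t\<bar> ^ 3 * b / 6"
    using n by (simp add: n_def)
  finally show ?thesis by (simp add: z_def n_def)
qed

section \<open>The Hoeffding decomposition of a U-statistic\<close>

definition U_stat :: "(nat \<Rightarrow> 'a \<Rightarrow> 'b) \<Rightarrow> ('b \<Rightarrow> 'b \<Rightarrow> real) \<Rightarrow> nat \<Rightarrow> 'a \<Rightarrow> real" where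
  "U_stat X h m \<omega> = (\<Sum>(i, j)\<in>index_pairs m. h (X i \<omega>) (X j \<omega>))"

locale iid_kernel = prob_space M for M :: "'a measure" +
  fixes S D :: "'b measure" and X :: "nat \<Rightarrow> 'a \<Rightarrow> 'b"
    and h :: "'b \<Rightarrow> 'b \<Rightarrow> real" and B :: real
  assumes indep: "indep_vars (\<lambda>_. S) X {1..}"
    and distr_X: "\<And>i. i \<ge> 1 \<Longrightarrow> distr M S (X i) = D"
    and h_measurable: "case_prod h \<in> borel_measurable (S \<Otimes>\<^sub>M S)"
    and h_sym: "\<And>x y. h x y = h y x"
    and h_bound: "\<And>x y. \<bar>h x y\<bar> \<le> B"
begin

abbreviation U :: "nat \<Rightarrow> 'a \<Rightarrow> real" where
  "U \<equiv> U_stat X h"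

lemma X_measurable: "i \<ge> 1 \<Longrightarrow> X i \<in> measurable M S"
  using indep by (auto simp: indep_vars_def2)

lemma sets_D [measurable_cong, simp]: "sets D = sets S"
  using distr_X[of 1] by auto

sublocale D: prob_space D
  using prob_space_distr[OF X_measurable[of 1]] distr_X[of 1] by simp

lemma expectation_X:
  fixes f :: "'b \<Rightarrow> real"
  assumes "i \<ge> 1" "f \<in> borel_measurable S"
  shows "expectation (\<lambda>\<omega>. f (X i \<omega>)) = (\<integral>x. f x \<partial>D)"
  using assms by (simp add: integral_distr X_measurable flip: distr_X[OF assms(1)])

text \<open>The kernel in a form that the measurability prover can apply to composed arguments.\<close>
lemma h_measurable' [measurable (raw)]:
  assumes "f \<in> measurable N S" "g \<in> measurable N S"
  shows "(\<lambda>x. h (f x) (g x)) \<in> borel_measurable N"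
  using measurable_compose[OF measurable_Pair[OF assms] h_measurable] by simp

definition kernel_mean :: real where
  "kernel_mean = (\<integral>x. \<integral>y. h x y \<partial>D \<partial>D)"

text \<open>The first-order projection of the kernel: up to a constant, the conditional expectation of
  \<open>h (X i) (X j)\<close> given \<open>X i\<close>.\<close>
definition proj :: "'b \<Rightarrow> real" where
  "proj x = (\<integral>y. h x y \<partial>D) - kernel_mean"

text \<open>The degenerate part of the kernel, whose conditional expectation given either argument vanishes.\<close>
definition resid :: "'b \<Rightarrow> 'b \<Rightarrow> real" where
  "resid x y = h x y - kernel_mean - proj x - proj y"

definition proj_var :: real where
  "proj_var = (\<integral>x. (proj x)\<^sup>2 \<partial>D)"

lemma B_nonneg: "B \<ge> 0"
  using h_bound[of undefined undefined] by linarith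

lemma section_measurable [measurable]: "(\<lambda>x. \<integral>y. h x y \<partial>D) \<in> borel_measurable S"
  by measurable

lemma proj_measurable [measurable]: "proj \<in> borel_measurable S"
  unfolding proj_def by measurable

lemma resid_measurable [measurable (raw)]:
  assumes [measurable]: "f \<in> measurable N S" "g \<in> measurable N S"
  shows "(\<lambda>x. resid (f x) (g x)) \<in> borel_measurable N"
  unfolding resid_def by measurable

text \<open>For a non-integrable \<open>f\<close> the integral is \<open>0\<close> by convention, and \<open>c\<close> is nonnegative.\<close>
lemma abs_integral_D_le:
  fixes f :: "'b \<Rightarrow> real"
  assumes "\<And>x. \<bar>f x\<bar> \<le> c"
  shows "\<bar>\<integral>x. f x \<partial>D\<bar> \<le> c"
proof (cases "integrable D f")
  case True
  have "\<bar>\<integral>x. f x \<partial>D\<bar> \<le> (\<integral>x. \<bar>f x\<bar> \<partial>D)" by (rule integral_abs_bound)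
  also have "\<dots> \<le> c" using True assms by (intro D.integral_le_const) auto
  finally show ?thesis .
next
  case False
  then show ?thesis using assms[of undefined] by (simp add: not_integrable_integral_eq)
qed

lemma kernel_mean_bound: "\<bar>kernel_mean\<bar> \<le> B"
  unfolding kernel_mean_def by (intro abs_integral_D_le h_bound)

lemma proj_bound: "\<bar>proj x\<bar> \<le> 2 * B"
  using abs_integral_D_le[of "h x", OF h_bound] kernel_mean_bound unfolding proj_def by linarith

lemma resid_bound: "\<bar>resid x y\<bar> \<le> 6 * B"
  using h_bound[of x y] kernel_mean_bound proj_bound[of x] proj_bound[of y]
  unfolding resid_def by linarith

lemma resid_sym: "resid x y = resid y x"
  by (simp add: resid_def h_sym[of x y])

lemma integrable_D [simp]:
  "integrable D (h x)" if "x \<in> space S"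
  using h_bound that by (intro D.integrable_const_bound[where B=B]) auto

lemma integrable_D_section [simp]: "integrable D (\<lambda>x. \<integral>y. h x y \<partial>D)"
  using abs_integral_D_le[OF h_bound] by (intro D.integrable_const_bound[where B=B]) auto

lemma integrable_D_proj [simp]: "integrable D proj"
  using proj_bound by (intro D.integrable_const_bound[where B="2*B"]) auto

lemma integral_proj: "(\<integral>x. proj x \<partial>D) = 0"
  unfolding proj_def by (simp add: D.prob_space) (simp add: kernel_mean_def)

lemma integral_resid: "x \<in> space S \<Longrightarrow> (\<integral>y. resid x y \<partial>D) = 0"
  unfolding resid_def by (simp add: D.prob_space integral_proj) (simp add: proj_def)

text \<open>An index \<open>j\<close> outside \<open>I\<close> is fresh: \<open>X j\<close> is independent of the whole family indexed by \<open>I\<close>, so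
  it can be integrated out first. In the applications \<open>F\<close> is a product in which only one factor
  involves the fresh variable, and this factor has mean \<open>0\<close> by \<open>integral_resid\<close> or \<open>integral_proj\<close>.\<close>
lemma expectation_eq_0_fresh:
  fixes F :: "(nat \<Rightarrow> 'b) \<Rightarrow> 'b \<Rightarrow> real"
  assumes j: "j \<ge> 1" "j \<notin> I" "I \<subseteq> {1..}"
    and F: "case_prod F \<in> borel_measurable (PiM I (\<lambda>_. S) \<Otimes>\<^sub>M S)"
    and bnd: "\<And>y x. \<bar>F y x\<bar> \<le> c"
    and zero: "\<And>y. y \<in> space (PiM I (\<lambda>_. S)) \<Longrightarrow> (\<integral>x. F y x \<partial>D) = 0"
  shows "expectation (\<lambda>\<omega>. F (restrict (\<lambda>i. X i \<omega>) I) (X j \<omega>)) = 0"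
proof -
  note X_measurable[measurable]
  have j': "j \<in> {1..}" using j by simp
  have ind: "indep_var (PiM I (\<lambda>_. S)) (\<lambda>\<omega>. restrict (\<lambda>i. X i \<omega>) I)
      (PiM {j} (\<lambda>_. S)) (\<lambda>\<omega>. restrict (\<lambda>i. X i \<omega>) {j})"
    using j by (intro indep_var_restrict[OF indep]) auto
  have F': "(\<lambda>p. F (fst p) (snd p j)) \<in> borel_measurable (PiM I (\<lambda>_. S) \<Otimes>\<^sub>M PiM {j} (\<lambda>_. S))"
    using measurable_compose[OF measurable_Pair[OF measurable_fst 
        measurable_compose[OF measurable_snd measurable_component_singleton[of j "{j}" "\<lambda>_. S"]]] F]
    by simp
  have [measurable]: "(\<lambda>\<omega>. restrict (\<lambda>i. X i \<omega>) I) \<in> measurable M (PiM I (\<lambda>_. S))"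
    using ind indep_var_rv1 by blast
  have Fy: "(\<lambda>x. F y x) \<in> borel_measurable S" if "y \<in> space (PiM I (\<lambda>_. S))" for y
    using measurable_compose[OF measurable_Pair1'[OF that] F] by simp
  have meas: "(\<lambda>\<omega>. F (restrict (\<lambda>i. X i \<omega>) I) (X j \<omega>)) \<in> borel_measurable M"
    using measurable_compose[OF measurable_Pair[OF _ X_measurable[OF j(1)]] F] by simp
  have "expectation (\<lambda>\<omega>. (\<lambda>p. F (fst p) (snd p j))
      (restrict (\<lambda>i. X i \<omega>) I, restrict (\<lambda>i. X i \<omega>) {j})) = 0"
  proof (rule expectation_eq_0_if_sections_0[OF ind F'])
    show "integrable M (\<lambda>\<omega>. F (fst (restrict (\<lambda>i. X i \<omega>) I, restrict (\<lambda>i. X i \<omega>) {j}))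
        (snd (restrict (\<lambda>i. X i \<omega>) I, restrict (\<lambda>i. X i \<omega>) {j}) j))"
      using meas bnd by (intro integrable_const_bound[where B=c]) auto
    fix y assume "y \<in> space (PiM I (\<lambda>_. S))"
    with zero[OF this] expectation_X[OF j(1) Fy[OF this]]
    show "expectation (\<lambda>\<omega>. F (fst (y, restrict (\<lambda>i. X i \<omega>) {j}))
        (snd (y, restrict (\<lambda>i. X i \<omega>) {j}) j)) = 0"
      by simp
  qed
  then show ?thesis by simp
qed

lemma resid_resid_bound: "\<bar>resid x y * resid z w\<bar> \<le> (6 * B) * (6 * B)"
  unfolding abs_mult by (intro mult_mono resid_bound) (use B_nonneg in auto)

lemma proj_proj_bound: "\<bar>proj x * proj y\<bar> \<le> (2 * B) * (2 * B)"
  unfolding abs_mult by (intro mult_mono proj_bound) (use B_nonneg in auto)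

lemma proj_resid_bound: "\<bar>proj x * resid y z\<bar> \<le> (2 * B) * (6 * B)"
  unfolding abs_mult by (intro mult_mono proj_bound resid_bound) (use B_nonneg in auto)

lemma resid_orth_fresh:
  assumes "i \<ge> 1" "j \<ge> 1" "k \<ge> 1" "l \<ge> 1" "j \<notin> {i, k, l}"
  shows "expectation (\<lambda>\<omega>. resid (X i \<omega>) (X j \<omega>) * resid (X k \<omega>) (X l \<omega>)) = 0"
proof -
  have "expectation (\<lambda>\<omega>. (\<lambda>f x. resid (f i) x * resid (f k) (f l))
      (restrict (\<lambda>i. X i \<omega>) {i, k, l}) (X j \<omega>)) = 0"
  proof (rule expectation_eq_0_fresh)
    show "\<bar>resid (f i) x * resid (f k) (f l)\<bar> \<le> (6 * B) * (6 * B)" for f x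
      by (rule resid_resid_bound)
    show "(\<integral>x. resid (f i) x * resid (f k) (f l) \<partial>D) = 0"
      if "f \<in> space (PiM {i, k, l} (\<lambda>_. S))" for f
      using integral_resid[of "f i"] that by (auto simp: space_PiM)
  qed (use assms in auto)
  then show ?thesis by simp
qed

text \<open>Two different increasing pairs are different as sets, so one endpoint of \<open>(i, j)\<close> is fresh
  for \<open>(k, l)\<close>; the symmetry of the kernel allows either endpoint to play this role.\<close>
lemma resid_orth:
  assumes "(i, j) \<in> index_pairs m" "(k, l) \<in> index_pairs m" "(i, j) \<noteq> (k, l)"
  shows "expectation (\<lambda>\<omega>. resid (X i \<omega>) (X j \<omega>) * resid (X k \<omega>) (X l \<omega>)) = 0"
proof (cases "j \<in> {k, l}")
  case False
  then show ?thesis using assms by (intro resid_orth_fresh) (auto simp: index_pairs_def)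
next
  case True
  then have "i \<notin> {k, l}" using assms by (auto simp: index_pairs_def)
  then have "expectation (\<lambda>\<omega>. resid (X j \<omega>) (X i \<omega>) * resid (X k \<omega>) (X l \<omega>)) = 0"
    using assms by (intro resid_orth_fresh) (auto simp: index_pairs_def)
  then show ?thesis by (simp add: resid_sym)
qed

lemma proj_resid_orth:
  assumes "(i, j) \<in> index_pairs m" "k \<ge> 1"
  shows "expectation (\<lambda>\<omega>. proj (X k \<omega>) * resid (X i \<omega>) (X j \<omega>)) = 0"
proof -
  have *: "expectation (\<lambda>\<omega>. proj (X k \<omega>) * resid (X i \<omega>) (X j \<omega>)) = 0"
    if "i \<ge> 1" "j \<ge> 1" "j \<notin> {i, k}" for i j
  proof -
    have "expectation (\<lambda>\<omega>. (\<lambda>f x. proj (f k) * resid (f i) x)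
        (restrict (\<lambda>i. X i \<omega>) {i, k}) (X j \<omega>)) = 0"
    proof (rule expectation_eq_0_fresh)
      show "\<bar>proj (f k) * resid (f i) x\<bar> \<le> (2 * B) * (6 * B)" for f x
        by (rule proj_resid_bound)
      show "(\<integral>x. proj (f k) * resid (f i) x \<partial>D) = 0"
        if "f \<in> space (PiM {i, k} (\<lambda>_. S))" for f
        using integral_resid[of "f i"] that by (auto simp: space_PiM)
    qed (use that assms in auto)
    then show ?thesis by simp
  qed
  show ?thesis
  proof (cases "j = k")
    case False
    then show ?thesis using assms by (intro *) (auto simp: index_pairs_def)
  next
    case True
    then have "expectation (\<lambda>\<omega>. proj (X k \<omega>) * resid (X j \<omega>) (X i \<omega>)) = 0"
      using assms by (intro *) (auto simp: index_pairs_def)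
    then show ?thesis by (simp add: resid_sym)
  qed
qed

lemma proj_orth:
  assumes "i \<ge> 1" "j \<ge> 1" "i \<noteq> j"
  shows "expectation (\<lambda>\<omega>. proj (X i \<omega>) * proj (X j \<omega>)) = 0"
proof -
  have "expectation (\<lambda>\<omega>. (\<lambda>f x. proj (f i) * proj x) (restrict (\<lambda>i. X i \<omega>) {i}) (X j \<omega>)) = 0"
  proof (rule expectation_eq_0_fresh)
    show "\<bar>proj (f i) * proj x\<bar> \<le> (2 * B) * (2 * B)" for f :: "nat \<Rightarrow> 'b" and x
      by (rule proj_proj_bound)
  qed (use assms integral_proj in auto)
  then show ?thesis by simp
qed

lemma resid_mean:
  assumes "(i, j) \<in> index_pairs m"
  shows "expectation (\<lambda>\<omega>. resid (X i \<omega>) (X j \<omega>)) = 0"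
proof -
  have "expectation (\<lambda>\<omega>. (\<lambda>f x. resid (f i) x) (restrict (\<lambda>i. X i \<omega>) {i}) (X j \<omega>)) = 0"
  proof (rule expectation_eq_0_fresh)
    show "\<bar>resid (f i) x\<bar> \<le> 6 * B" for f :: "nat \<Rightarrow> 'b" and x
      by (rule resid_bound)
  qed (use assms in \<open>auto simp: index_pairs_def space_PiM intro!: integral_resid\<close>)
  then show ?thesis by simp
qed

definition linear_part :: "nat \<Rightarrow> 'a \<Rightarrow> real" where
  "linear_part m \<omega> = (\<Sum>i=1..m. proj (X i \<omega>))"

definition degenerate_part :: "nat \<Rightarrow> 'a \<Rightarrow> real" where
  "degenerate_part m \<omega> = (\<Sum>(i, j)\<in>index_pairs m. resid (X i \<omega>) (X j \<omega>))"

lemma hoeffding_decomposition: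
  "U m \<omega> = real (card (index_pairs m)) * kernel_mean + (real m - 1) * linear_part m \<omega> + degenerate_part m \<omega>"
proof -
  have "U m \<omega> = (\<Sum>(i, j)\<in>index_pairs m. kernel_mean + (proj (X i \<omega>) + proj (X j \<omega>)) + resid (X i \<omega>) (X j \<omega>))"
    unfolding U_stat_def by (intro sum.cong) (auto simp: resid_def)
  also have "\<dots> = real (card (index_pairs m)) * kernel_mean
      + (\<Sum>(i, j)\<in>index_pairs m. proj (X i \<omega>) + proj (X j \<omega>)) + degenerate_part m \<omega>"
    by (simp add: degenerate_part_def sum.distrib case_prod_unfold)
  finally show ?thesis by (simp add: sum_index_pairs_endpoints linear_part_def)
qed

lemma proj_X_measurable [measurable]: "i \<ge> 1 \<Longrightarrow> (\<lambda>\<omega>. proj (X i \<omega>)) \<in> borel_measurable M"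
  using X_measurable by measurable

lemma resid_X_measurable [measurable]:
  "i \<ge> 1 \<Longrightarrow> j \<ge> 1 \<Longrightarrow> (\<lambda>\<omega>. resid (X i \<omega>) (X j \<omega>)) \<in> borel_measurable M"
  using X_measurable by measurable

lemma linear_part_measurable [measurable]: "linear_part m \<in> borel_measurable M"
  unfolding linear_part_def by measurable

lemma degenerate_part_measurable [measurable]: "degenerate_part m \<in> borel_measurable M"
  unfolding degenerate_part_def case_prod_unfold
  by (rule borel_measurable_sum) (auto simp: index_pairs_def intro!: resid_X_measurable)

lemma U_measurable [measurable]: "U m \<in> borel_measurable M"
  unfolding hoeffding_decomposition by measurable

lemma expectation_linear_part_power2:
  shows "integrable M (\<lambda>\<omega>. (linear_part m \<omega>)\<^sup>2)" (is ?int)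
    and "expectation (\<lambda>\<omega>. (linear_part m \<omega>)\<^sup>2) = real m * proj_var" (is ?eq)
proof -
  have int: "integrable M (\<lambda>\<omega>. proj (X i \<omega>) * proj (X j \<omega>))"
    if "i \<in> {1..m}" "j \<in> {1..m}" for i j
    using that proj_proj_bound
    by (intro integrable_const_bound[where B="(2 * B) * (2 * B)"])
       (auto intro!: borel_measurable_times proj_X_measurable)
  have orth: "expectation (\<lambda>\<omega>. proj (X i \<omega>) * proj (X j \<omega>)) = 0"
    if "i \<in> {1..m}" "j \<in> {1..m}" "i \<noteq> j" for i j
    using that by (intro proj_orth) auto
  note * = expectation_power2_orthogonal_sum[of "{1..m}" "\<lambda>i \<omega>. proj (X i \<omega>)", OF _ int orth]
  show ?int using *(1) by (simp add: linear_part_def)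
  have "expectation (\<lambda>\<omega>. (linear_part m \<omega>)\<^sup>2) = (\<Sum>i=1..m. expectation (\<lambda>\<omega>. (proj (X i \<omega>))\<^sup>2))"
    using *(2) by (simp add: linear_part_def)
  also have "\<dots> = (\<Sum>i=1..m. proj_var)"
    unfolding proj_var_def by (intro sum.cong expectation_X) auto
  finally show ?eq by simp
qed

text \<open>By orthogonality the off-diagonal terms vanish, so the second moment is of the order of the number
  of pairs, a factor \<open>m\<close> smaller than that of \<open>(m - 1) * linear_part m\<close>. The constant is half of
  \<open>6\<^sup>2\<close>, from \<open>resid_bound\<close>.\<close>
lemma expectation_degenerate_part_power2:
  shows "integrable M (\<lambda>\<omega>. (degenerate_part m \<omega>)\<^sup>2)" (is ?int)
    and "expectation (\<lambda>\<omega>. (degenerate_part m \<omega>)\<^sup>2) \<le> real m * (real m - 1) * (18 * B\<^sup>2)" (is ?le)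
proof -
  let ?Y = "\<lambda>p \<omega>. resid (X (fst p) \<omega>) (X (snd p) \<omega>)"
  have int: "integrable M (\<lambda>\<omega>. ?Y p \<omega> * ?Y q \<omega>)" if "p \<in> index_pairs m" "q \<in> index_pairs m" for p q
    using that resid_resid_bound
    by (intro integrable_const_bound[where B="(6 * B) * (6 * B)"])
       (auto simp: index_pairs_def intro!: borel_measurable_times resid_X_measurable)
  have orth: "expectation (\<lambda>\<omega>. ?Y p \<omega> * ?Y q \<omega>) = 0"
    if "p \<in> index_pairs m" "q \<in> index_pairs m" "p \<noteq> q" for p q
    using that by (intro resid_orth[of _ _ m]) (auto simp: prod_eq_iff)
  note * = expectation_power2_orthogonal_sum[of "index_pairs m" ?Y, OF _ int orth]
  show ?int using *(1) by (simp add: degenerate_part_def case_prod_unfold)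
  have "expectation (\<lambda>\<omega>. (degenerate_part m \<omega>)\<^sup>2) = (\<Sum>p\<in>index_pairs m. expectation (\<lambda>\<omega>. (?Y p \<omega>)\<^sup>2))"
    using *(2) by (simp add: degenerate_part_def case_prod_unfold)
  also have "\<dots> \<le> (\<Sum>p\<in>index_pairs m. 36 * B\<^sup>2)"
  proof (rule sum_mono)
    fix p assume p: "p \<in> index_pairs m"
    have "(?Y p \<omega>)\<^sup>2 \<le> 36 * B\<^sup>2" for \<omega>
      using resid_resid_bound[of "X (fst p) \<omega>" "X (snd p) \<omega>" "X (fst p) \<omega>" "X (snd p) \<omega>"]
      by (simp add: power2_eq_square)
    then show "expectation (\<lambda>\<omega>. (?Y p \<omega>)\<^sup>2) \<le> 36 * B\<^sup>2"
      using int[OF p p] by (intro integral_le_const) (auto simp: power2_eq_square)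
  qed
  also have "\<dots> = real m * (real m - 1) * (18 * B\<^sup>2)"
    by (simp add: card_index_pairs)
  finally show ?le .
qed

lemma linear_degenerate_orth:
  shows "integrable M (\<lambda>\<omega>. linear_part m \<omega> * degenerate_part m \<omega>)" and "expectation (\<lambda>\<omega>. linear_part m \<omega> * degenerate_part m \<omega>) = 0"
proof -
  let ?f = "\<lambda>k p \<omega>. proj (X k \<omega>) * resid (X (fst p) \<omega>) (X (snd p) \<omega>)"
  have eq: "linear_part m \<omega> * degenerate_part m \<omega> = (\<Sum>k=1..m. \<Sum>p\<in>index_pairs m. ?f k p \<omega>)" for \<omega>
    by (simp add: linear_part_def degenerate_part_def sum_product case_prod_unfold)
  have int: "integrable M (?f k p)" if "k \<in> {1..m}" "p \<in> index_pairs m" for k p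
    using that proj_resid_bound
    by (intro integrable_const_bound[where B="(2 * B) * (6 * B)"])
       (auto simp: index_pairs_def
         intro!: borel_measurable_times proj_X_measurable resid_X_measurable)
  show "integrable M (\<lambda>\<omega>. linear_part m \<omega> * degenerate_part m \<omega>)"
    unfolding eq by (intro Bochner_Integration.integrable_sum int)
  have "expectation (\<lambda>\<omega>. linear_part m \<omega> * degenerate_part m \<omega>) = (\<Sum>k=1..m. \<Sum>p\<in>index_pairs m. expectation (?f k p))"
    unfolding eq by (simp add: Bochner_Integration.integral_sum int Bochner_Integration.integrable_sum)
  also have "\<dots> = 0"
    by (intro sum.neutral ballI proj_resid_orth) auto
  finally show "expectation (\<lambda>\<omega>. linear_part m \<omega> * degenerate_part m \<omega>) = 0" .
qed

lemma expectation_U: "expectation (U m) = real (card (index_pairs m)) * kernel_mean"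
proof -
  have intL: "integrable M (linear_part m)"
    using square_integrable_imp_integrable[OF _ expectation_linear_part_power2(1)] by simp
  have intR: "integrable M (degenerate_part m)"
    using square_integrable_imp_integrable[OF _ expectation_degenerate_part_power2(1)] by simp
  have "integrable M (\<lambda>\<omega>. proj (X i \<omega>))" if "i \<in> {1..m}" for i
    using that proj_bound
    by (intro integrable_const_bound[where B="2 * B"]) (auto intro!: proj_X_measurable)
  then have L: "expectation (linear_part m) = 0"
    by (simp add: linear_part_def[abs_def] expectation_X integral_proj)
  have "integrable M (\<lambda>\<omega>. resid (X (fst p) \<omega>) (X (snd p) \<omega>))" if "p \<in> index_pairs m" for p
    using that resid_bound
    by (intro integrable_const_bound[where B="6 * B"])
       (auto simp: index_pairs_def intro!: resid_X_measurable)
  moreover have "expectation (\<lambda>\<omega>. resid (X (fst p) \<omega>) (X (snd p) \<omega>)) = 0" if "p \<in> index_pairs m" for p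
    using that by (intro resid_mean[of _ _ m]) simp
  ultimately have R: "expectation (degenerate_part m) = 0"
    by (simp add: degenerate_part_def[abs_def] case_prod_unfold)
  show ?thesis
    unfolding hoeffding_decomposition[abs_def] using intL intR by (simp add: L R prob_space)
qed

text \<open>The first error term comes from dropping the degenerate part, the second from the Taylor
  approximation for the linear part. Since only \<open>\<theta>\<close>, \<open>t\<close> and \<open>m\<close> occur in the bound, it is uniform
  over all distributions and kernels with the same \<open>\<theta>\<close>.\<close>
lemma char_standardized_U_approx:
  assumes m: "m \<ge> 2" and v: "proj_var > 0" and t: "t\<^sup>2 \<le> 4 * real m"
  defines "\<theta> \<equiv> sqrt (B\<^sup>2 / (real m * proj_var))"
  shows "cmod (char (distr M borel (standardized M (U m))) t - (1 + (- (t\<^sup>2) / 2) / real m) ^ m)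
    \<le> (6 * \<bar>t\<bar> + \<bar>t\<bar> ^ 3 / 3) * \<theta>"
proof -
  define c where "c = sqrt (real m * proj_var)"
  define a where "a = (real m - 1) * c"
  define r where "r = expectation (\<lambda>\<omega>. (degenerate_part m \<omega>)\<^sup>2)"
  define T where "T \<omega> = (real m - 1) * linear_part m \<omega>" for \<omega>
  have c: "c > 0" and c2: "c\<^sup>2 = real m * proj_var" using m v by (auto simp: c_def)
  have a: "a > 0" using m c by (simp add: a_def)
  have \<theta>: "\<theta> = B / c" using B_nonneg by (simp add: \<theta>_def c_def real_sqrt_divide)
  have [measurable]: "T \<in> borel_measurable M" unfolding T_def[abs_def] by measurable
  have T2: "integrable M (\<lambda>\<omega>. (T \<omega>)\<^sup>2)" "expectation (\<lambda>\<omega>. (T \<omega>)\<^sup>2) = a\<^sup>2"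
    using expectation_linear_part_power2[of m] by (simp_all add: T_def a_def power_mult_distrib c2)
  have TR: "integrable M (\<lambda>\<omega>. T \<omega> * degenerate_part m \<omega>)" "expectation (\<lambda>\<omega>. T \<omega> * degenerate_part m \<omega>) = 0"
    using linear_degenerate_orth[of m] by (simp_all add: T_def mult.assoc)
  note R2 = expectation_degenerate_part_power2[of m]
  have centered: "U m \<omega> - expectation (U m) = T \<omega> + degenerate_part m \<omega>" for \<omega>
    by (simp add: expectation_U hoeffding_decomposition T_def)
  have "variance (U m) = expectation (\<lambda>\<omega>. (T \<omega>)\<^sup>2 + (degenerate_part m \<omega>)\<^sup>2 + 2 * (T \<omega> * degenerate_part m \<omega>))"
    unfolding centered by (simp add: power2_sum mult.assoc)
  also have "\<dots> = a\<^sup>2 + r"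
    using T2 TR R2(1) by (simp add: r_def)
  finally have std: "standardized M (U m) = (\<lambda>\<omega>. (T \<omega> + degenerate_part m \<omega>) / sqrt (a\<^sup>2 + r))"
    by (simp add: fun_eq_iff standardized_def centered)
  note L2 = standardized_orthogonal_sum_L2[OF T2(1) R2(1) TR a T2(2) r_def[symmetric]]
  have ra: "r / a\<^sup>2 \<le> (6 * \<theta>)\<^sup>2"
  proof -
    have "r / a\<^sup>2 \<le> (real m * (real m - 1) * (18 * B\<^sup>2)) / a\<^sup>2"
      using R2(2) by (intro divide_right_mono) (auto simp: r_def)
    also have "\<dots> = real m / (real m - 1) * 18 * (B\<^sup>2 / c\<^sup>2)"
    proof -
      have "real m * k * (18 * B\<^sup>2) / (k * c)\<^sup>2 = real m / k * 18 * (B\<^sup>2 / c\<^sup>2)" if "k > 0" for k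
        using that c by (simp add: power2_eq_square mult_ac)
      from this[of "real m - 1"] show ?thesis using m by (simp add: a_def)
    qed
    \<comment> \<open>\<open>m / (m - 1) \<le> 2\<close> is where \<open>m \<ge> 2\<close> enters.\<close>
    also have "\<dots> \<le> 2 * 18 * (B\<^sup>2 / c\<^sup>2)"
      using m by (intro mult_right_mono) (auto simp: field_simps)
    finally show ?thesis by (simp add: \<theta> power_mult_distrib power_divide)
  qed
  have "cmod (char (distr M borel (standardized M (U m))) t - char (distr M borel (\<lambda>\<omega>. T \<omega> / a)) t)
      \<le> \<bar>t\<bar> * sqrt (expectation (\<lambda>\<omega>. ((T \<omega> + degenerate_part m \<omega>) / sqrt (a\<^sup>2 + r) - T \<omega> / a)\<^sup>2))"
    unfolding std by (rule char_diff_le_L2) (use L2(1) in auto)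
  also have "\<dots> \<le> \<bar>t\<bar> * sqrt ((6 * \<theta>)\<^sup>2)"
    using L2(2) ra by (intro mult_left_mono real_sqrt_le_mono) auto
  also have "\<dots> = 6 * \<bar>t\<bar> * \<theta>"
    using \<theta> c B_nonneg by simp
  finally have 1: "cmod (char (distr M borel (standardized M (U m))) t
      - char (distr M borel (\<lambda>\<omega>. T \<omega> / a)) t) \<le> 6 * \<bar>t\<bar> * \<theta>" .
  have Ta: "(\<lambda>\<omega>. T \<omega> / a) = (\<lambda>\<omega>. \<Sum>i\<in>{1..m}. proj (X i \<omega>) / c)"
    using m by (auto simp: fun_eq_iff T_def a_def linear_part_def sum_divide_distrib)
  have "cmod (char (distr M borel (\<lambda>\<omega>. \<Sum>i\<in>{1..m}. proj (X i \<omega>) / c)) t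
      - (1 + (- (t\<^sup>2) / 2) / real (card {1..m})) ^ card {1..m}) \<le> \<bar>t\<bar> ^ 3 * (2 * \<theta>) / 6"
  proof (rule char_normalized_sum_approx)
    show "indep_vars (\<lambda>_. borel) (\<lambda>i \<omega>. proj (X i \<omega>) / c) {1..m}"
      by (rule indep_vars_compose2[where M'="\<lambda>_. S"], rule indep_vars_subset[OF indep]) auto
    show "\<bar>proj (X i \<omega>) / c\<bar> \<le> 2 * \<theta>" for i \<omega>
      using proj_bound[of "X i \<omega>"] c by (simp add: \<theta> divide_right_mono)
    show "expectation (\<lambda>\<omega>. proj (X i \<omega>) / c) = 0" if "i \<in> {1..m}" for i
      using that by (simp add: expectation_X integral_proj)
    show "expectation (\<lambda>\<omega>. (proj (X i \<omega>) / c)\<^sup>2) = 1 / card {1..m}" if "i \<in> {1..m}" for i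
    proof -
      have "expectation (\<lambda>\<omega>. (proj (X i \<omega>))\<^sup>2) = proj_var"
        unfolding proj_var_def by (rule expectation_X) (use that in auto)
      then show ?thesis using v by (simp add: power_divide c2)
    qed
  qed (use m t in auto)
  then have 2: "cmod (char (distr M borel (\<lambda>\<omega>. T \<omega> / a)) t - (1 + (- (t\<^sup>2) / 2) / real m) ^ m) \<le> \<bar>t\<bar> ^ 3 / 3 * \<theta>"
    by (simp add: Ta mult_ac)
  show ?thesis
    using norm_triangle_ineq[of "char (distr M borel (standardized M (U m))) t - char (distr M borel (\<lambda>\<omega>. T \<omega> / a)) t"
        "char (distr M borel (\<lambda>\<omega>. T \<omega> / a)) t - (1 + (- (t\<^sup>2) / 2) / real m) ^ m"] 1 2
    by (simp add: algebra_simps)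
qed

end

section \<open>A central limit theorem for triangular arrays of U-statistics\<close>

lemma standardized_measurable:
  "f \<in> borel_measurable M \<Longrightarrow> standardized M f \<in> borel_measurable M"
  unfolding standardized_def[abs_def]
  by (intro borel_measurable_divide borel_measurable_diff borel_measurable_const)

text \<open>Both errors at a given \<open>t\<close> are multiples of the square root of the sequence in \<open>small\<close>. The
  hypotheses start at \<open>m = 2\<close>, where the first pair appears; Levy's theorem wants a random variable
  for every \<open>m\<close>, and below \<open>2\<close> the statistic is the empty sum.\<close>
lemma (in prob_space) U_statistic_triangular_CLT:
  fixes X :: "nat \<Rightarrow> nat \<Rightarrow> 'a \<Rightarrow> 'b" and h :: "nat \<Rightarrow> 'b \<Rightarrow> 'b \<Rightarrow> real"
  assumes kernel: "\<And>m. m \<ge> 2 \<Longrightarrow> iid_kernel M S (D m) (X m) (h m) (B m)"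
    and var_pos: "\<And>m. m \<ge> 2 \<Longrightarrow> iid_kernel.proj_var (D m) (h m) > 0"
    and small: "(\<lambda>m. (B m)\<^sup>2 / (real m * iid_kernel.proj_var (D m) (h m))) \<longlonglongrightarrow> 0"
  shows "weak_conv_m (\<lambda>m. distr M borel (standardized M (U_stat (X m) (h m) m)))
    std_normal_distribution"
proof (rule levy_continuity)
  fix m
  have "U_stat (X m) (h m) m \<in> borel_measurable M"
  proof (cases "m \<ge> 2")
    case True
    interpret iid_kernel M S "D m" "X m" "h m" "B m" by (rule kernel[OF True])
    show ?thesis by (rule U_measurable)
  next
    case False
    then have "index_pairs m = {}" by (auto simp: index_pairs_def)
    then show ?thesis by (simp add: U_stat_def[abs_def])
  qed
  then show "real_distribution (distr M borel (standardized M (U_stat (X m) (h m) m)))"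
    by (intro real_distribution_distr standardized_measurable)
next
  fix t :: real
  define err where "err m = (6 * \<bar>t\<bar> + \<bar>t\<bar> ^ 3 / 3) *
    sqrt ((B m)\<^sup>2 / (real m * iid_kernel.proj_var (D m) (h m)))" for m
  have err: "err \<longlonglongrightarrow> 0"
    unfolding err_def using tendsto_mult_right_zero[OF tendsto_real_sqrt[OF small, simplified]] by simp
  let ?\<phi> = "\<lambda>m. char (distr M borel (standardized M (U_stat (X m) (h m) m))) t"
  have "\<forall>\<^sub>F m in sequentially. cmod (?\<phi> m - (1 + (- (t\<^sup>2) / 2) / real m) ^ m) \<le> err m"
  proof (rule eventually_sequentiallyI)
    fix m assume "m \<ge> max 2 (nat \<lceil>t\<^sup>2\<rceil>)"
    then have m: "m \<ge> 2" and t: "t\<^sup>2 \<le> 4 * real m" by linarith+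
    interpret iid_kernel M S "D m" "X m" "h m" "B m" by (rule kernel[OF m])
    show "cmod (?\<phi> m - (1 + (- (t\<^sup>2) / 2) / real m) ^ m) \<le> err m"
      unfolding err_def by (rule char_standardized_U_approx[OF m var_pos[OF m] t])
  qed
  from Lim_null_comparison[OF this err]
  have *: "(\<lambda>m. ?\<phi> m - (1 + (- (t\<^sup>2) / 2) / real m) ^ m) \<longlonglongrightarrow> 0" .
  have "(\<lambda>m. complex_of_real ((1 + (- (t\<^sup>2) / 2) / real m) ^ m)) \<longlonglongrightarrow> complex_of_real (exp (- (t\<^sup>2) / 2))"
    by (rule isCont_tendsto_compose [OF _ tendsto_exp_limit_sequentially]) auto
  then have "(\<lambda>m. (1 + (- (t\<^sup>2) / 2) / real m) ^ m) \<longlonglongrightarrow> complex_of_real (exp (- (t\<^sup>2) / 2))"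
    by simp
  from Lim_transform[OF this *]
  show "?\<phi> \<longlonglongrightarrow> char std_normal_distribution t"
    by (simp add: char_std_normal_distribution)
qed (rule real_dist_normal_dist)

section \<open>The variance of the projected gcd kernel\<close>

text \<open>The pairs \<open>(x, 2 * x)\<close> with \<open>x\<close> odd are disjoint, because \<open>x\<close> is odd and \<open>2 * x\<close> is even. A jump of
  \<open>1 / 3\<close> across a pair forces its two squares to sum to at least \<open>1 / 18\<close>, and at least
  \<open>n / 5\<close> such pairs fit into \<open>{1..n}\<close> (the proportion is smallest at \<open>n = 5\<close>).\<close>
lemma sum_power2_ge_if_jump_at_double:
  fixes p :: "nat \<Rightarrow> real"
  assumes "n \<ge> 2" and jump: "\<And>x. odd x \<Longrightarrow> 2 * x \<le> n \<Longrightarrow> p (2 * x) - p x \<ge> 1 / 3"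
  shows "(\<Sum>x=1..n. (p x)\<^sup>2) \<ge> real n / 90"
proof -
  define odds where "odds = {x. odd x \<and> 2 * x \<le> n}"
  have odds_sub: "odds \<subseteq> {1..n}" by (auto simp: odds_def Suc_le_eq intro: odd_pos)
  then have fin: "finite odds" by (rule finite_subset) simp
  have "(\<lambda>k. 2 * k + 1) ` {..<(n + 2) div 4} \<subseteq> odds" by (auto simp: odds_def)
  from card_mono[OF fin this] have "(n + 2) div 4 \<le> card odds"
    by (simp add: card_image inj_on_def)
  moreover have "n \<le> 5 * ((n + 2) div 4)" using \<open>n \<ge> 2\<close> by presburger
  ultimately have card_odds: "real n \<le> 5 * real (card odds)" by linarith
  have "1 / 18 \<le> (p x)\<^sup>2 + (p (2 * x))\<^sup>2" if "x \<in> odds" for x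
  proof -
    have "1 / 3 \<le> p (2 * x) - p x" using jump that by (auto simp: odds_def)
    then have "(1 / 3)\<^sup>2 \<le> (p (2 * x) - p x)\<^sup>2" by (intro power_mono) auto
    also have "\<dots> \<le> 2 * ((p x)\<^sup>2 + (p (2 * x))\<^sup>2)"
      using zero_le_power2[of "p x + p (2 * x)"] by (simp add: power2_sum power2_diff mult_ac)
    finally show ?thesis by (simp add: power_divide)
  qed
  then have "(\<Sum>x\<in>odds. 1 / 18) \<le> (\<Sum>x\<in>odds. (p x)\<^sup>2 + (p (2 * x))\<^sup>2)"
    by (rule sum_mono)
  then have "real (card odds) / 18 \<le> (\<Sum>x\<in>odds. (p x)\<^sup>2) + (\<Sum>x\<in>odds. (p (2 * x))\<^sup>2)"
    by (simp add: sum.distrib)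
  also have "(\<Sum>x\<in>odds. (p (2 * x))\<^sup>2) = (\<Sum>x\<in>(*) 2 ` odds. (p x)\<^sup>2)"
    by (subst sum.reindex) (auto simp: inj_on_def)
  also have "(\<Sum>x\<in>odds. (p x)\<^sup>2) + (\<Sum>x\<in>(*) 2 ` odds. (p x)\<^sup>2) = (\<Sum>x\<in>odds \<union> (*) 2 ` odds. (p x)\<^sup>2)"
    using fin by (intro sum.union_disjoint[symmetric]) (auto simp: odds_def)
  also have "\<dots> \<le> (\<Sum>x=1..n. (p x)\<^sup>2)"
    using odds_sub by (intro sum_mono2) (auto simp: odds_def Suc_le_eq odd_pos)
  finally show ?thesis using card_odds by simp
qed

text \<open>Doubling an odd \<open>x\<close> never decreases the gcd with \<open>y\<close> and doubles it, hence raises it by at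
  least \<open>1\<close>, for each of the \<open>n div 2\<close> even \<open>y\<close>. The worst ratio \<open>(n div 2) / n\<close> is \<open>1 / 3\<close>, at \<open>n = 3\<close>.\<close>
lemma sum_gcd_double_diff:
  assumes "odd x" "n \<ge> 2"
  shows "real n / 3 \<le> (\<Sum>y=1..n. real (gcd (2 * x) y)) - (\<Sum>y=1..n. real (gcd x y))"
proof -
  have "(*) 2 ` {1..n div 2} \<subseteq> {y \<in> {1..n}. even y}" by auto
  from card_mono[OF _ this] have card: "n div 2 \<le> card {y \<in> {1..n}. even y}"
    by (simp add: card_image inj_on_def)
  have le: "(if even y then 1 else 0) \<le> real (gcd (2 * x) y) - real (gcd x y)" if "y \<in> {1..n}" for y
  proof (cases "even y")
    case True
    have "x > 0" using \<open>odd x\<close> by (rule odd_pos)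
    then have "gcd x y \<ge> 1" by (simp add: Suc_le_eq)
    from True obtain z where z: "y = 2 * z" by blast
    have "coprime x 2" using \<open>odd x\<close> by simp
    then have "gcd x y = gcd x z" unfolding z by (metis gcd.commute gcd_mult_left_left_cancel)
    then have "gcd (2 * x) y = 2 * gcd x y" unfolding z by (simp add: gcd_mult_distrib_nat[symmetric])
    with \<open>gcd x y \<ge> 1\<close> True show ?thesis by simp
  next
    case False
    have "gcd x y dvd gcd (2 * x) y" by (simp add: gcd_dvdI1)
    then have "gcd x y \<le> gcd (2 * x) y" using that by (intro dvd_imp_le) auto
    with False show ?thesis by simp
  qed
  have "n \<le> 3 * (n div 2)" using \<open>n \<ge> 2\<close> by presburger
  then have "real n / 3 \<le> real (n div 2)" by linarith
  also have "\<dots> \<le> real (card {y \<in> {1..n}. even y})" using card by simp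
  also have "\<dots> = (\<Sum>y=1..n. if even y then 1 else 0)"
    by (simp add: sum.If_cases Int_def)
  also have "\<dots> \<le> (\<Sum>y=1..n. real (gcd (2 * x) y) - real (gcd x y))"
    by (intro sum_mono le)
  finally show ?thesis by (simp add: sum_subtractf)
qed

text \<open>The uniform variables lie in \<open>{1..n}\<close> only almost surely. Cutting the gcd off outside this range
  makes the kernel bounded everywhere and changes the sums only on a null set.\<close>
definition truncated_gcd :: "nat \<Rightarrow> nat \<Rightarrow> nat \<Rightarrow> real" where
  "truncated_gcd n x y = (if x \<in> {1..n} \<and> y \<in> {1..n} then real (gcd x y) else 0)"

lemma borel_measurable_count_space_pair:
  fixes f :: "'b::countable \<times> 'c::countable \<Rightarrow> real"
  shows "f \<in> borel_measurable (count_space UNIV \<Otimes>\<^sub>M count_space UNIV)"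
  by (simp add: pair_measure_countable)

lemma (in prob_space) iid_kernel_truncated_gcd:
  fixes X :: "nat \<Rightarrow> 'a \<Rightarrow> nat"
  assumes "indep_vars (\<lambda>_. count_space UNIV) X {1..}"
    and "\<And>i. i \<ge> 1 \<Longrightarrow> distr M (count_space UNIV) (X i) = measure_pmf (pmf_of_set {1..n})"
  shows "iid_kernel M (count_space UNIV) (measure_pmf (pmf_of_set {1..n})) X (truncated_gcd n) (real n)"
proof
  show "\<bar>truncated_gcd n x y\<bar> \<le> real n" for x y
  proof (cases "x \<in> {1..n} \<and> y \<in> {1..n}")
    case True
    then have "gcd x y \<le> x" "x \<le> n" by (auto intro: gcd_le1_nat)
    then have "gcd x y \<le> n" by (rule order_trans)
    then show ?thesis by (simp add: truncated_gcd_def)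
  qed (auto simp: truncated_gcd_def)
  show "truncated_gcd n x y = truncated_gcd n y x" for x y
    by (auto simp: truncated_gcd_def gcd.commute)
qed (use assms in \<open>auto intro: borel_measurable_count_space_pair\<close>)

lemma (in prob_space) proj_var_truncated_gcd:
  fixes X :: "nat \<Rightarrow> 'a \<Rightarrow> nat"
  assumes "indep_vars (\<lambda>_. count_space UNIV) X {1..}"
    and "\<And>i. i \<ge> 1 \<Longrightarrow> distr M (count_space UNIV) (X i) = measure_pmf (pmf_of_set {1..n})"
    and n: "n \<ge> 2"
  shows "iid_kernel.proj_var (measure_pmf (pmf_of_set {1..n})) (truncated_gcd n) \<ge> 1 / 90"
proof -
  let ?D = "measure_pmf (pmf_of_set {1..n})"
  interpret iid_kernel M "count_space UNIV" ?D X "truncated_gcd n" "real n"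
    by (rule iid_kernel_truncated_gcd) (use assms in auto)
  have int: "(\<integral>x. f x \<partial>?D) = (\<Sum>x=1..n. f x) / real n" for f :: "nat \<Rightarrow> real"
    using n by (simp add: integral_pmf_of_set)
  have proj_eq: "proj x = (\<Sum>y=1..n. real (gcd x y)) / real n - kernel_mean" if "x \<in> {1..n}" for x
    using that unfolding proj_def int by (simp add: truncated_gcd_def)
  have "real n / 90 \<le> (\<Sum>x=1..n. (proj x)\<^sup>2)"
  proof (rule sum_power2_ge_if_jump_at_double[OF n])
    fix x :: nat assume x: "odd x" "2 * x \<le> n"
    then have range: "x \<in> {1..n}" "2 * x \<in> {1..n}" using odd_pos[OF x(1)] by auto
    then have "proj (2 * x) - proj x
        = ((\<Sum>y=1..n. real (gcd (2 * x) y)) - (\<Sum>y=1..n. real (gcd x y))) / real n"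
      unfolding proj_eq[OF range(1)] proj_eq[OF range(2)] by (simp add: diff_divide_distrib)
    also have "\<dots> \<ge> (real n / 3) / real n"
      by (intro divide_right_mono sum_gcd_double_diff x n) simp
    finally show "proj (2 * x) - proj x \<ge> 1 / 3" using n by simp
  qed
  then show ?thesis unfolding proj_var_def int using n by (simp add: field_simps)
qed

section \<open>The central limit theorem for sums of gcds\<close>

lemma (in prob_space) standardized_cong_AE:
  assumes "f \<in> borel_measurable M" "g \<in> borel_measurable M" "AE \<omega> in M. f \<omega> = g \<omega>"
  shows "distr M borel (standardized M f) = distr M borel (standardized M g)"
proof (rule distr_cong_AE)
  note [measurable] = assms(1,2)
  have E: "expectation f = expectation g"
    using assms(3) by (intro integral_cong_AE) auto
  then have "variance f = variance g"
    using assms(3) by (intro integral_cong_AE) auto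
  with E show "AE \<omega> in M. standardized M f \<omega> = standardized M g \<omega>"
    using assms(3) by (auto simp: standardized_def)
qed (use assms in \<open>auto intro: standardized_measurable\<close>)

lemma (in prob_space) distr_standardized_gcd_sum:
  fixes X :: "nat \<Rightarrow> 'a \<Rightarrow> nat"
  assumes ind: "indep_vars (\<lambda>_. count_space UNIV) X {1..}"
    and unif: "\<And>i. i \<ge> 1 \<Longrightarrow> distr M (count_space UNIV) (X i) = measure_pmf (pmf_of_set {1..n})"
    and n: "n \<ge> 1"
  shows "distr M borel (standardized M (gcd_sum X m)) = distr M borel (standardized M (U_stat X (truncated_gcd n) m))"
proof (rule standardized_cong_AE)
  interpret iid_kernel M "count_space UNIV" "measure_pmf (pmf_of_set {1..n})" X "truncated_gcd n" "real n"
    by (rule iid_kernel_truncated_gcd[OF ind unif])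
  have gcd_sum_eq: "gcd_sum X m = U_stat X (\<lambda>x y. real (gcd x y)) m"
    by (simp add: fun_eq_iff gcd_sum_def U_stat_def index_pairs_def)
  show "gcd_sum X m \<in> borel_measurable M"
    unfolding gcd_sum_eq U_stat_def[abs_def] case_prod_unfold
  proof (rule borel_measurable_sum)
    fix p assume "p \<in> index_pairs m"
    then have "X (fst p) \<in> measurable M (count_space UNIV)" "X (snd p) \<in> measurable M (count_space UNIV)"
      by (auto simp: index_pairs_def intro!: X_measurable)
    from measurable_compose[OF measurable_Pair[OF this] borel_measurable_count_space_pair[of "\<lambda>(x, y). real (gcd x y)"]]
    show "(\<lambda>\<omega>. real (gcd (X (fst p) \<omega>) (X (snd p) \<omega>))) \<in> borel_measurable M" by simp
  qed
  show "U m \<in> borel_measurable M" by simp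
  have range: "AE \<omega> in M. X i \<omega> \<in> {1..n}" if "i \<ge> 1" for i
  proof -
    have "AE x in distr M (count_space UNIV) (X i). x \<in> {1..n}"
      unfolding unif[OF that] using n by (simp add: AE_measure_pmf_iff)
    then show ?thesis using X_measurable[OF that] by (subst (asm) AE_distr_iff) auto
  qed
  have "AE \<omega> in M. \<forall>i\<in>{1..m}. X i \<omega> \<in> {1..n}"
    using range by (intro AE_finite_allI) auto
  then show "AE \<omega> in M. gcd_sum X m \<omega> = U m \<omega>"
  proof (rule AE_mp, intro AE_I2 impI)
    fix \<omega> assume "\<forall>i\<in>{1..m}. X i \<omega> \<in> {1..n}"
    then show "gcd_sum X m \<omega> = U m \<omega>"
      unfolding gcd_sum_eq U_stat_def
      by (intro sum.cong refl) (auto simp: index_pairs_def truncated_gcd_def)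
  qed
qed

lemma (in prob_space) gcd_sum_triangular_CLT:
  fixes X :: "nat \<Rightarrow> nat \<Rightarrow> 'a \<Rightarrow> nat" and N :: "nat \<Rightarrow> nat"
  assumes ind: "\<And>n. n \<ge> 1 \<Longrightarrow> indep_vars (\<lambda>_. count_space UNIV) (X n) {1..}"
    and unif: "\<And>n i. n \<ge> 1 \<Longrightarrow> i \<ge> 1 \<Longrightarrow>
      distr M (count_space UNIV) (X n i) = measure_pmf (pmf_of_set {1..n})"
    and N: "\<And>m. m \<ge> 2 \<Longrightarrow> N m \<ge> 2"
    and small: "(\<lambda>m. (real (N m))\<^sup>2 / real m) \<longlonglongrightarrow> 0"
  shows "weak_conv_m (\<lambda>m. distr M borel (standardized M (gcd_sum (X (N m)) m))) std_normal_distribution"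
proof -
  let ?D = "\<lambda>m. measure_pmf (pmf_of_set {1..N m})"
  let ?v = "\<lambda>m. iid_kernel.proj_var (?D m) (truncated_gcd (N m))"
  have N1: "N m \<ge> 1" if "m \<ge> 2" for m using N[OF that] by linarith
  have v: "?v m \<ge> 1 / 90" if "m \<ge> 2" for m
    by (rule proj_var_truncated_gcd[OF ind[OF N1[OF that]] unif[OF N1[OF that]] N[OF that]])
  have "weak_conv_m (\<lambda>m. distr M borel (standardized M (U_stat (X (N m)) (truncated_gcd (N m)) m)))
      std_normal_distribution"
  proof (rule U_statistic_triangular_CLT)
    show "iid_kernel M (count_space UNIV) (?D m) (X (N m)) (truncated_gcd (N m)) (real (N m))"
      if "m \<ge> 2" for m
      by (rule iid_kernel_truncated_gcd[OF ind[OF N1[OF that]] unif[OF N1[OF that]]])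
    show "?v m > 0" if "m \<ge> 2" for m using v[OF that] by linarith
    show "(\<lambda>m. (real (N m))\<^sup>2 / (real m * ?v m)) \<longlonglongrightarrow> 0"
    proof (rule Lim_null_comparison)
      show "\<forall>\<^sub>F m in sequentially. norm ((real (N m))\<^sup>2 / (real m * ?v m)) \<le> 90 * ((real (N m))\<^sup>2 / real m)"
      proof (rule eventually_sequentiallyI)
        fix m :: nat assume m: "m \<ge> 2"
        have "(real (N m))\<^sup>2 / (real m * ?v m) \<le> (real (N m))\<^sup>2 / (real m * (1 / 90))"
          using v[OF m] m by (intro divide_left_mono mult_left_mono mult_pos_pos) auto
        then show "norm ((real (N m))\<^sup>2 / (real m * ?v m)) \<le> 90 * ((real (N m))\<^sup>2 / real m)"
          using v[OF m] by (simp add: mult.commute)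
      qed
      show "(\<lambda>m. 90 * ((real (N m))\<^sup>2 / real m)) \<longlonglongrightarrow> 0"
        by (rule tendsto_mult_right_zero[OF small])
    qed
  qed
  moreover have "distr M borel (standardized M (gcd_sum (X (N m)) m))
      = distr M borel (standardized M (U_stat (X (N m)) (truncated_gcd (N m)) m))" for m
  proof (cases "m \<ge> 2")
    case True
    show ?thesis by (rule distr_standardized_gcd_sum[OF ind[OF N1[OF True]] unif[OF N1[OF True]] N1[OF True]])
  next
    case False
    then have "index_pairs m = {}" by (auto simp: index_pairs_def)
    then have "gcd_sum (X (N m)) m = U_stat (X (N m)) (truncated_gcd (N m)) m"
      by (simp add: fun_eq_iff gcd_sum_def U_stat_def index_pairs_def[symmetric] del: One_nat_def)
    then show ?thesis by simp
  qed
  ultimately show ?thesis by simp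
qed

theorem theorem2:
  fixes M :: "'a measure" and X :: "nat \<Rightarrow> nat \<Rightarrow> 'a \<Rightarrow> nat"
  assumes "prob_space M"
    and indep: "\<And>n. n \<ge> 1 \<Longrightarrow> prob_space.indep_vars M (\<lambda>_. count_space UNIV) (X n) {1..}"
    and unif: "\<And>n i. n \<ge> 1 \<Longrightarrow> i \<ge> 1 \<Longrightarrow>
      distr M (count_space UNIV) (X n i) = measure_pmf (pmf_of_set {1..n})"
  shows "(\<forall>n\<ge>2. weak_conv_m (\<lambda>m. distr M borel (standardized M (gcd_sum (X n) m)))
            std_normal_distribution) \<and>
    (\<forall>(\<beta>::real) (N :: nat \<Rightarrow> nat). \<beta> < 1/2 \<longrightarrow> (\<forall>m\<ge>2. N m \<ge> 2) \<longrightarrow>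
        (\<forall>\<^sub>F m in sequentially. real (N m) \<le> real m powr \<beta>) \<longrightarrow>
        weak_conv_m (\<lambda>m. distr M borel (standardized M (gcd_sum (X (N m)) m)))
          std_normal_distribution)"
proof (intro conjI allI impI)
  interpret prob_space M by fact
  fix n :: nat assume "n \<ge> 2"
  show "weak_conv_m (\<lambda>m. distr M borel (standardized M (gcd_sum (X n) m))) std_normal_distribution"
  proof (rule gcd_sum_triangular_CLT[where N="\<lambda>_. n", OF indep unif \<open>n \<ge> 2\<close>])
    show "(\<lambda>m. (real n)\<^sup>2 / real m) \<longlonglongrightarrow> 0"
      by (rule lim_const_over_n)
  qed
next
  interpret prob_space M by fact
  fix \<beta> :: real and N :: "nat \<Rightarrow> nat"
  assume \<beta>: "\<beta> < 1 / 2" and N: "\<forall>m\<ge>2. N m \<ge> 2"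
    and le: "\<forall>\<^sub>F m in sequentially. real (N m) \<le> real m powr \<beta>"
  show "weak_conv_m (\<lambda>m. distr M borel (standardized M (gcd_sum (X (N m)) m))) std_normal_distribution"
  proof (rule gcd_sum_triangular_CLT[OF indep unif])
    show "(\<lambda>m. (real (N m))\<^sup>2 / real m) \<longlonglongrightarrow> 0"
    proof (rule Lim_null_comparison)
      show "\<forall>\<^sub>F m in sequentially. norm ((real (N m))\<^sup>2 / real m) \<le> real m powr (2 * \<beta> - 1)"
        using le eventually_gt_at_top[of 0]
      proof eventually_elim
        case (elim m)
        have "(real (N m))\<^sup>2 \<le> (real m powr \<beta>)\<^sup>2" using elim by (intro power_mono) auto
        also have "\<dots> = real m powr (2 * \<beta>)"
          by (simp add: power2_eq_square flip: powr_add)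
        finally show ?case using elim by (simp add: powr_diff divide_right_mono)
      qed
      show "(\<lambda>m. real m powr (2 * \<beta> - 1)) \<longlonglongrightarrow> 0"
        using \<beta> by (intro tendsto_neg_powr filterlim_real_sequentially) simp
    qed
  qed (use N in auto)
qed

end
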